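(* Let $s,t\ge 0$ and let $i_1<\cdots<i_s$ and $j_1<\cdots<j_t$ be fixed nonnegative integer constants, and for each $n$ let $$S_n=\{i_1<i_2<\cdots<i_s<n-j_t<\cdots<n-j_2<n-j_1\}.$$ Suppose $S_n$ is admissible, i.e. $\#P(S_n;n)\ne0$ for some $n$. Then there is a polynomial $p(n)$, integer-valued at all integers, such that $\#P(S_n;n)=p(n)\,2^{n-\#S_n-1}$ for every $n$ with $\#P(S_n;n)\neq0$, and $$\deg p(n)=\begin{cases}0 & \text{if } s=t=0,\\ i_s-1 & \text{if } s>0,\ t=0,\\ j_t & \text{if } s=0,\ t>0,\\ i_s+j_t-1 & \text{otherwise.}\end{cases}$$
   Context: For a permutation $\pi=a_1\ldots a_n$ of $\{1,\ldots,n\}$, an index $i$ is a peak if $a_{i-1}<a_i>a_{i+1}$. For a set $S$ of positive integers, $P(S;n)$ is the set of permutations of $\{1,\dots,n\}$ whose set of peaks is exactly $S$. *)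

theory Defs
  imports "HOL-Combinatorics.Permutations" "HOL-Computational_Algebra.Polynomial"
begin

text \<open>
  A permutation \<open>a\<^sub>1 \<dots> a\<^sub>n\<close> of \<open>{1..n}\<close> is a function \<open>\<pi>\<close> with \<open>\<pi> permutes {1..n}\<close> and
  \<open>a\<^sub>i = \<pi> i\<close>.  The bounds on \<open>i\<close> say that \<open>a\<^sub>i\<close> has two neighbours; they are
  needed because \<open>\<pi>\<close> is the identity, rather than undefined, outside \<open>{1..n}\<close>.
\<close>

definition peak_set :: "nat \<Rightarrow> (nat \<Rightarrow> nat) \<Rightarrow> nat set" where
  "peak_set n \<pi> = {i. 1 < i \<and> i < n \<and> \<pi> (i - 1) < \<pi> i \<and> \<pi> i > \<pi> (i + 1)}"

definition peak_perms :: "nat set \<Rightarrow> nat \<Rightarrow> (nat \<Rightarrow> nat) set" where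
  "peak_perms S n = {\<pi>. \<pi> permutes {1..n} \<and> peak_set n \<pi> = S}"

text \<open>
  The set \<open>{i\<^sub>1 < \<dots> < i\<^sub>s < n - j\<^sub>t < \<dots> < n - j\<^sub>1}\<close>.  The inequalities are part of the
  notation: \<open>two_sided_ok\<close> singles out the \<open>n \<ge> 1\<close> for which the entries \<open>n - j\<^sub>k\<close> are
  positive and lie to the right of the entries \<open>i\<^sub>k\<close>.  In particular the subtractions
  are not truncated for those \<open>n\<close>, and the \<open>s + t\<close> entries are distinct.
\<close>

definition two_sided_set ::
    "nat \<Rightarrow> nat \<Rightarrow> (nat \<Rightarrow> nat) \<Rightarrow> (nat \<Rightarrow> nat) \<Rightarrow> nat \<Rightarrow> nat set" where
  "two_sided_set s t i j n = i ` {1..s} \<union> (\<lambda>k. n - j k) ` {1..t}"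

definition two_sided_ok ::
    "nat \<Rightarrow> nat \<Rightarrow> (nat \<Rightarrow> nat) \<Rightarrow> (nat \<Rightarrow> nat) \<Rightarrow> nat \<Rightarrow> bool" where
  "two_sided_ok s t i j n \<longleftrightarrow>
     1 \<le> n \<and> (t > 0 \<longrightarrow> j t < n) \<and> (s > 0 \<and> t > 0 \<longrightarrow> i s < n - j t)"

end

theory Submission imports Defs begin

text \<open>
  Let \<open>m\<close> be the largest element of the left block \<open>I\<close>, put \<open>A = I - {m}\<close>, and let \<open>R\<close> be the right
  block. Choose the set of the first \<open>m - 1\<close> entries, arrange them with peak set \<open>A\<close>, and arrange the
  other \<open>n - m + 1\<close> entries with peaks exactly at the positions of \<open>R\<close>. A peak of the concatenation that
  is visible in neither part lies at \<open>m - 1\<close> or \<open>m\<close>, and not at both. So the product of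
  \<open>n choose (m - 1)\<close> and the two counts is the sum of the numbers of permutations with peak sets
  \<open>A \<union> R\<close>, \<open>A \<union> {m - 1} \<union> R\<close> and \<open>I \<union> R\<close>. Induction on \<open>m\<close> then gives a
  polynomial for \<open>I \<union> R\<close>. The binomial coefficient raises the degree to \<open>m - 1\<close> above that of the
  polynomial for \<open>R\<close>, and the other two terms have smaller degree. The polynomial for \<open>R\<close> alone comes
  from the one-sided case by reversing permutations, and that case starts from the \<open>2 ^ (n - 1)\<close>
  permutations without peaks.
\<close>

section \<open>Permutations as words over arbitrary finite sets\<close>

text \<open>Peak positions are counted from 1, list indices from 0.\<close>

definition list_peaks :: "nat list \<Rightarrow> nat set" where
  "list_peaks xs = {i. 1 < i \<and> i < length xs \<and> xs ! (i - 2) < xs ! (i - 1) \<and> xs ! i < xs ! (i - 1)}"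

text \<open>Over an arbitrary \<open>V\<close>, because the two halves of a permutation carry
  complementary sets of values, which in general are not initial segments.\<close>

definition peak_words :: "nat set \<Rightarrow> nat set \<Rightarrow> nat list set" where
  "peak_words V S = {xs. distinct xs \<and> set xs = V \<and> list_peaks xs = S}"

lemma finite_peak_words [simp]: "finite V \<Longrightarrow> finite (peak_words V S)"
  by (rule finite_subset[OF _ finite_lists_length_eq[of V "card V"]])
     (auto simp: peak_words_def distinct_card)

lemma length_peak_words: "xs \<in> peak_words V S \<Longrightarrow> length xs = card V"
  by (auto simp: peak_words_def distinct_card)

text \<open>Peaks depend only on the relative order of the entries, so the increasing bijection
  \<open>h\<close> from \<open>{0..<n}\<close> to \<open>V\<close> carries permutations to words and
  preserves their peaks.\<close>

lemma card_peak_words: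
  assumes "finite V"
  shows "card (peak_words V S) = card (peak_perms S (card V))"
proof -
  define n where "n = card V"
  obtain h where h: "bij_betw h {0..<n} V" and mono: "strict_mono_on {0..<n} h"
    using ex_bij_betw_strict_mono_card[OF assms] by (metis lessThan_atLeast0 n_def)
  \<comment> \<open>The two shifts by one pass between positions and values counted from 1 and list
    indices and arguments of \<open>h\<close> counted from 0.\<close>
  define F where "F \<pi> = map (\<lambda>i. h (\<pi> (Suc i) - 1)) [0..<n]" for \<pi> :: "nat \<Rightarrow> nat"
  have h_less: "h (x - 1) < h (y - 1) \<longleftrightarrow> x < y" if "1 \<le> x \<and> x \<le> n" "1 \<le> y \<and> y \<le> n" for x y
  proof -
    have "x - 1 \<in> {0..<n}" "y - 1 \<in> {0..<n}" using that by auto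
    then have "h (x - 1) < h (y - 1) \<longleftrightarrow> x - 1 < y - 1" by (rule strict_mono_on_less[OF mono])
    with that show ?thesis by linarith
  qed
  have shift: "bij_betw (\<lambda>i. i - 1) {1..n} {0..<n}"
    by (rule bij_betwI[where g = Suc]) auto
  have shift': "bij_betw Suc {0..<n} {1..n}"
    by (rule bij_betwI[where g = "\<lambda>i. i - 1"]) auto
  have peaks: "list_peaks (F \<pi>) = peak_set n \<pi>" if "\<pi> permutes {1..n}" for \<pi>
  proof -
    have rng: "1 \<le> \<pi> i \<and> \<pi> i \<le> n" if "1 \<le> i" "i \<le> n" for i
      using permutes_in_image[OF \<open>\<pi> permutes {1..n}\<close>, of i] that by simp
    have "i \<in> list_peaks (F \<pi>) \<longleftrightarrow> i \<in> peak_set n \<pi>" for i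
    proof (cases "1 < i \<and> i < n")
      case True
      then have idx: "F \<pi> ! (i - 2) = h (\<pi> (i - 1) - 1)" "F \<pi> ! (i - 1) = h (\<pi> i - 1)"
        "F \<pi> ! i = h (\<pi> (Suc i) - 1)" "length (F \<pi>) = n"
        by (auto simp: F_def Suc_diff_Suc numeral_2_eq_2)
      have rng':  "1 \<le> \<pi> (i - 1) \<and> \<pi> (i - 1) \<le> n" "1 \<le> \<pi> i \<and> \<pi> i \<le> n" "1 \<le> \<pi> (Suc i) \<and> \<pi> (Suc i) \<le> n"
        using True rng[of "i - 1"] rng[of i] rng[of "Suc i"] by linarith+
      show ?thesis using True h_less[OF rng'(1,2)] h_less[OF rng'(3,2)]
        by (simp only: list_peaks_def peak_set_def mem_Collect_eq idx) simp
    qed (auto simp: list_peaks_def peak_set_def F_def)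
    then show ?thesis by blast
  qed
  have word: "distinct (F \<pi>) \<and> set (F \<pi>) = V" if "\<pi> permutes {1..n}" for \<pi>
  proof -
    have b: "bij_betw (h \<circ> (\<lambda>i. i - 1) \<circ> \<pi> \<circ> Suc) {0..<n} V"
      using shift' permutes_imp_bij[OF that] shift h by (intro bij_betw_trans)
    show ?thesis
      using bij_betw_imp_surj_on[OF b] bij_betw_imp_inj_on[OF b]
      by (simp add: F_def distinct_map comp_def)
  qed
  have "bij_betw F (peak_perms S n) (peak_words V S)"
    unfolding bij_betw_def
  proof
    show "inj_on F (peak_perms S n)"
    proof (rule inj_onI)
      fix \<pi> \<sigma> assume p: "\<pi> \<in> peak_perms S n" and s: "\<sigma> \<in> peak_perms S n" and eq: "F \<pi> = F \<sigma>"
      have pp: "\<pi> permutes {1..n}" and ss: "\<sigma> permutes {1..n}"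
        using p s by (auto simp: peak_perms_def)
      show "\<pi> = \<sigma>"
      proof
        fix i show "\<pi> i = \<sigma> i"
        proof (cases "i \<in> {1..n}")
          case True
          then have "F \<pi> ! (i - 1) = F \<sigma> ! (i - 1)" using eq by simp
          moreover have "F \<tau> ! (i - 1) = h (\<tau> i - 1)" for \<tau>
            using True by (auto simp: F_def)
          ultimately have "h (\<pi> i - 1) = h (\<sigma> i - 1)" by simp
          moreover have "\<pi> i \<in> {1..n}" "\<sigma> i \<in> {1..n}"
            using True permutes_in_image[OF pp] permutes_in_image[OF ss] by blast+
          ultimately have "\<pi> i - 1 = \<sigma> i - 1"
            using inj_onD[OF bij_betw_imp_inj_on[OF h], of "\<pi> i - 1" "\<sigma> i - 1"] by fastforce
          then show ?thesis using \<open>\<pi> i \<in> {1..n}\<close> \<open>\<sigma> i \<in> {1..n}\<close> by auto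
        qed (use pp ss in \<open>simp add: permutes_def\<close>)
      qed
    qed
    show "F ` peak_perms S n = peak_words V S"
    proof
      show "F ` peak_perms S n \<subseteq> peak_words V S"
        using word peaks by (auto simp: peak_perms_def peak_words_def)
      show "peak_words V S \<subseteq> F ` peak_perms S n"
      proof
        fix xs assume xs: "xs \<in> peak_words V S"
        have len: "length xs = n" using length_peak_words[OF xs] by (simp add: n_def)
        have ds: "distinct xs" "set xs = V" using xs by (auto simp: peak_words_def)
        define g where "g = the_inv_into {0..<n} h"
        have g: "bij_betw g V {0..<n}" using h by (simp add: g_def bij_betw_the_inv_into)
        have nth: "bij_betw ((!) xs) {0..<n} V"
          using bij_betw_nth[OF ds(1)] len ds(2) by (simp add: lessThan_atLeast0)
        \<comment> \<open>The preimage of \<open>xs\<close> under \<open>F\<close>: \<open>g\<close>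
          ranks the letters from 0, and \<open>permutes\<close> forces the identity outside
          \<open>{1..n}\<close>.\<close>
        define \<pi> where "\<pi> i = (if i \<in> {1..n} then Suc (g (xs ! (i - 1))) else i)" for i
        have "bij_betw (Suc \<circ> g \<circ> (!) xs \<circ> (\<lambda>i. i - 1)) {1..n} {1..n}"
          using shift nth g shift' by (intro bij_betw_trans)
        then have "bij_betw \<pi> {1..n} {1..n}"
          by (rule bij_betw_cong[THEN iffD1, rotated]) (simp add: \<pi>_def)
        then have perm: "\<pi> permutes {1..n}"
          by (rule bij_imp_permutes) (auto simp: \<pi>_def)
        have "F \<pi> = xs"
        proof (rule nth_equalityI)
          fix i assume "i < length (F \<pi>)"
          then have i: "i < n" by (simp add: F_def)
          then have "xs ! i \<in> V" using len ds(2) nth_mem by blast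
          then have "h (g (xs ! i)) = xs ! i"
            unfolding g_def by (rule f_the_inv_into_f_bij_betw[OF h])
          with i show "F \<pi> ! i = xs ! i" by (simp add: F_def \<pi>_def)
        qed (simp add: F_def len)
        then show "xs \<in> F ` peak_perms S n"
          using perm peaks[OF perm] xs by (auto simp: peak_perms_def peak_words_def)
      qed
    qed
  qed
  then show ?thesis unfolding n_def by (rule bij_betw_same_card[symmetric])
qed

section \<open>Cutting a word in two\<close>

lemma list_peaks_take: "k \<le> length xs \<Longrightarrow> list_peaks (take k xs) = list_peaks xs \<inter> {..<k}"
  by (auto simp: list_peaks_def)

lemma list_peaks_drop: "list_peaks (drop k xs) = {i. 1 < i \<and> k + i \<in> list_peaks xs}"
proof -
  have "i \<in> list_peaks (drop k xs) \<longleftrightarrow> 1 < i \<and> k + i \<in> list_peaks xs" for i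
  proof (cases "1 < i \<and> k + i < length xs")
    case True
    then have "k + i - 2 = k + (i - 2)" "k + i - 1 = k + (i - 1)" by auto
    with True show ?thesis by (auto simp: list_peaks_def)
  qed (auto simp: list_peaks_def)
  then show ?thesis by blast
qed

lemma list_peaks_not_adjacent: "i \<in> list_peaks xs \<Longrightarrow> Suc i \<notin> list_peaks xs"
  by (auto simp: list_peaks_def)

text \<open>Once the set \<open>U\<close> of the first \<open>k\<close> letters is chosen, the two
  halves vary independently, and their numbers depend only on the sizes \<open>k\<close> and
  \<open>card V - k\<close>, not on \<open>U\<close>.\<close>

lemma card_split_words:
  assumes "finite V" "k \<le> card V"
  shows "card {xs. distinct xs \<and> set xs = V \<and> list_peaks (take k xs) = A \<and> list_peaks (drop k xs) = B}
    = (card V choose k) * card (peak_perms A k) * card (peak_perms B (card V - k))"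
    (is "card ?D = _")
proof -
  define C where "C = (SIGMA U:{U. U \<subseteq> V \<and> card U = k}. peak_words U A \<times> peak_words (V - U) B)"
  have sub: "U \<subseteq> V \<Longrightarrow> finite U" for U using assms(1) finite_subset by blast
  have "bij_betw (\<lambda>(U, ys, zs). ys @ zs) C ?D"
  proof (rule bij_betwI[where g = "\<lambda>xs. (set (take k xs), take k xs, drop k xs)"])
    show "(\<lambda>(U, ys, zs). ys @ zs) \<in> C \<rightarrow> ?D"
    proof (clarsimp simp: C_def)
      fix U ys zs
      assume "U \<subseteq> V" "k = card U" and ys: "ys \<in> peak_words U A" and zs: "zs \<in> peak_words (V - U) B"
      with length_peak_words[OF ys]
      show "distinct ys \<and> distinct zs \<and> set ys \<inter> set zs = {} \<and> set ys \<union> set zs = V \<and>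
        list_peaks (take (card U) ys @ take (card U - length ys) zs) = A \<and>
        list_peaks (drop (card U) ys @ drop (card U - length ys) zs) = B"
        by (auto simp: peak_words_def)
    qed
    show "(\<lambda>xs. (set (take k xs), take k xs, drop k xs)) \<in> ?D \<rightarrow> C"
    proof
      fix xs assume "xs \<in> ?D"
      then have xs: "distinct xs" "set xs = V" "list_peaks (take k xs) = A" "list_peaks (drop k xs) = B"
        by auto
      have len: "length xs = card V" using distinct_card[OF xs(1)] xs(2) by simp
      have "set (take k xs) \<inter> set (drop k xs) = {}"
        using xs(1) by (simp add: set_take_disj_set_drop_if_distinct)
      moreover have "set (take k xs) \<union> set (drop k xs) = V"
        using xs(2) by (metis append_take_drop_id set_append)
      ultimately have "V - set (take k xs) = set (drop k xs)" by blast
      then show "(set (take k xs), take k xs, drop k xs) \<in> C"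
        using xs len assms set_take_subset[of k xs]
        by (auto simp: C_def peak_words_def distinct_card)
    qed
    fix x assume "x \<in> C"
    then obtain U ys zs where x: "x = (U, ys, zs)" "card U = k" "ys \<in> peak_words U A"
      by (auto simp: C_def)
    have "length ys = k" "set ys = U"
      using length_peak_words[OF x(3)] x(2,3) by (auto simp: peak_words_def)
    then show "(\<lambda>xs. (set (take k xs), take k xs, drop k xs)) ((\<lambda>(U, ys, zs). ys @ zs) x) = x"
      by (simp add: x(1))
  qed simp
  then have "card ?D = card C" by (rule bij_betw_same_card[symmetric])
  also have "\<dots> = (\<Sum>U | U \<subseteq> V \<and> card U = k. card (peak_words U A \<times> peak_words (V - U) B))"
    unfolding C_def using assms(1) sub by (intro card_SigmaI) auto
  also have "\<dots> = (\<Sum>U | U \<subseteq> V \<and> card U = k. card (peak_perms A k) * card (peak_perms B (card V - k)))"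
    using assms(1) sub by (intro sum.cong) (auto simp: card_cartesian_product card_peak_words card_Diff_subset)
  finally show ?thesis by (simp add: n_subsets[OF assms(1)])
qed

text \<open>Three consecutive entries lie within one half of the cut unless the middle one is at
  \<open>k\<close> or \<open>Suc k\<close>. The assumptions on \<open>A\<close> and \<open>B\<close>
  keep \<open>S\<close> clear of these two positions, so the three peak sets on the right are
  distinct.\<close>

lemma peak_perms_recurrence:
  assumes A: "A \<subseteq> {..<k}" and B: "B \<subseteq> {2..}" and "k \<le> n"
  defines "S \<equiv> A \<union> (+) k ` B"
  shows "(n choose k) * card (peak_perms A k) * card (peak_perms B (n - k)) =
    card (peak_perms S n) + card (peak_perms (insert k S) n) + card (peak_perms (insert (Suc k) S) n)"
proof -
  let ?V = "{1..n}"
  let ?D = "{xs. distinct xs \<and> set xs = ?V \<and> list_peaks (take k xs) = A \<and> list_peaks (drop k xs) = B}"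
  have new: "k \<notin> S" "Suc k \<notin> S" using A B by (auto simp: S_def)
  have iff: "list_peaks (take k xs) = A \<and> list_peaks (drop k xs) = B \<longleftrightarrow>
      list_peaks xs = S \<or> list_peaks xs = insert k S \<or> list_peaks xs = insert (Suc k) S"
    (is "?L \<longleftrightarrow> ?R") if "length xs = n" for xs
  proof
    let ?P = "list_peaks xs"
    assume ?L
    then have l: "?P \<inter> {..<k} = A" and r: "{i. 1 < i \<and> k + i \<in> ?P} = B"
      using that \<open>k \<le> n\<close> by (simp_all add: list_peaks_take list_peaks_drop)
    \<comment> \<open>Below \<open>k\<close> the prefix decides; above \<open>Suc k\<close> the
      suffix does, with positions shifted by \<open>k\<close>.\<close>
    have "i \<in> ?P \<longleftrightarrow> i \<in> S" if "i \<noteq> k" "i \<noteq> Suc k" for i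
    proof (cases "i < k")
      case True
      then show ?thesis using l by (auto simp: S_def)
    next
      case False
      with that have "1 < i - k" "i = k + (i - k)" by auto
      then have "i \<in> ?P \<longleftrightarrow> i - k \<in> B" unfolding r[symmetric] by simp
      also have "\<dots> \<longleftrightarrow> i \<in> S" using A False \<open>i = k + (i - k)\<close> by (auto simp: S_def)
      finally show ?thesis .
    qed
    moreover have "\<not> (k \<in> ?P \<and> Suc k \<in> ?P)" using list_peaks_not_adjacent by blast
    moreover have "?P = S" if "k \<notin> ?P" "Suc k \<notin> ?P"
      using calculation(1) that new by (intro set_eqI) metis
    moreover have "?P = insert k S" if "k \<in> ?P" "Suc k \<notin> ?P"
      using calculation(1) that new by (intro set_eqI) (metis insert_iff)
    moreover have "?P = insert (Suc k) S" if "k \<notin> ?P" "Suc k \<in> ?P"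
      using calculation(1) that new by (intro set_eqI) (metis insert_iff)
    ultimately show ?R by blast
  next
    assume ?R
    \<comment> \<open>The prefix sees only positions below \<open>k\<close> and the suffix only
      those from \<open>k + 2\<close> on, so neither notices an added \<open>k\<close> or
      \<open>Suc k\<close>.\<close>
    then show ?L using that \<open>k \<le> n\<close> A B
      by (auto simp: list_peaks_take list_peaks_drop S_def)
  qed
  have "?D = peak_words ?V S \<union> peak_words ?V (insert k S) \<union> peak_words ?V (insert (Suc k) S)"
    (is "_ = ?W1 \<union> ?W2 \<union> ?W3")
  proof -
    have "xs \<in> ?D \<longleftrightarrow> xs \<in> ?W1 \<union> ?W2 \<union> ?W3" for xs
    proof (cases "distinct xs \<and> set xs = ?V")
      case True
      then have "length xs = n" using distinct_card[of xs] by simp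
      then show ?thesis using True iff[of xs] by (auto simp: peak_words_def)
    qed (auto simp: peak_words_def)
    then show ?thesis by blast
  qed
  moreover have "?W1 \<inter> ?W2 = {}" "(?W1 \<union> ?W2) \<inter> ?W3 = {}"
    using new by (auto simp: peak_words_def dest: equalityD1)
  ultimately have "card ?D = card ?W1 + card ?W2 + card ?W3"
    by (simp add: card_Un_disjoint)
  then show ?thesis
    using card_split_words[of ?V k A B] \<open>k \<le> n\<close> by (simp add: card_peak_words)
qed

section \<open>Words without peaks\<close>

lemma list_peaks_Cons_greatest:
  assumes "\<And>y. y \<in> set ys \<Longrightarrow> y < x"
  shows "list_peaks (x # ys) = {} \<longleftrightarrow> list_peaks ys = {}"
proof
  assume "list_peaks (x # ys) = {}"
  then show "list_peaks ys = {}" using list_peaks_drop[of 1 "x # ys"] by simp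
next
  assume e: "list_peaks ys = {}"
  have "i \<notin> list_peaks (x # ys)" for i
  proof
    assume i: "i \<in> list_peaks (x # ys)"
    \<comment> \<open>A peak at 2 would make the first letter of \<open>ys\<close> exceed
      \<open>x\<close>. Any other peak already lies in \<open>ys\<close>, one position
      earlier.\<close>
    then have "i \<noteq> 2" using less_asym[OF assms[OF nth_mem, of 0]] by (fastforce simp: list_peaks_def)
    with i have "1 < i - 1 \<and> 1 + (i - 1) \<in> list_peaks (x # ys)" by (auto simp: list_peaks_def)
    then show False using e list_peaks_drop[of 1 "x # ys"] by auto
  qed
  then show "list_peaks (x # ys) = {}" by blast
qed

lemma list_peaks_snoc_greatest:
  assumes "\<And>y. y \<in> set ys \<Longrightarrow> y < x"
  shows "list_peaks (ys @ [x]) = {} \<longleftrightarrow> list_peaks ys = {}"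
proof -
  \<comment> \<open>The only new candidate is position \<open>length ys\<close>, whose right
    neighbour is the greatest letter.\<close>
  have "i < length ys" if i: "i \<in> list_peaks (ys @ [x])" for i
  proof (rule ccontr)
    assume "\<not> i < length ys"
    then have "i = length ys" "0 < i" using i by (auto simp: list_peaks_def)
    then have "x < ys ! (i - 1)" "i - 1 < length ys"
      using i by (auto simp: list_peaks_def nth_append)
    then show False using assms nth_mem less_asym by blast
  qed
  then show ?thesis using list_peaks_take[of "length ys" "ys @ [x]"] by auto
qed

text \<open>A greatest letter strictly inside a word is a peak, so in a peak-free word it stands at
  an end. Removing it leaves a peak-free word, and the choice between the two ends doubles the count
  with each further letter.\<close>

lemma card_no_peak_words:
  "finite V \<Longrightarrow> card V = Suc n \<Longrightarrow> card (peak_words V {}) = 2 ^ n"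
proof (induction n arbitrary: V)
  case 0
  then obtain v where "V = {v}" by (auto simp: card_Suc_eq)
  then have "peak_words V {} = {[v]}"
  proof -
    have "xs = [v]" if "xs \<in> peak_words V {}" for xs
      using length_peak_words[OF that] that \<open>V = {v}\<close>
      by (auto simp: peak_words_def length_Suc_conv)
    moreover have "[v] \<in> peak_words V {}"
      using \<open>V = {v}\<close> by (simp add: peak_words_def list_peaks_def)
    ultimately show ?thesis by blast
  qed
  then show ?case by simp
next
  case (Suc n)
  let ?M = "Max V" and ?W = "peak_words (V - {Max V}) {}"
  have M: "?M \<in> V" and le: "\<And>v. v \<in> V \<Longrightarrow> v \<le> ?M"
    using Suc.prems by (auto intro: Max_in)
  have cV: "card (V - {?M}) = Suc n" using M Suc.prems by simp
  have W: "card ?W = 2 ^ n" using Suc.IH[of "V - {?M}"] Suc.prems(1) cV by blast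
  have lt: "y < ?M" if "y \<in> V - {?M}" for y using le[of y] that by auto
  have "peak_words V {} = (#) ?M ` ?W \<union> (\<lambda>ys. ys @ [?M]) ` ?W"
  proof (intro equalityI subsetI)
    fix xs assume xs: "xs \<in> peak_words V {}"
    then have d: "distinct xs" "set xs = V" "list_peaks xs = {}" by (auto simp: peak_words_def)
    obtain ys zs where split: "xs = ys @ ?M # zs" using M d(2) split_list by fast
    have sets: "set ys \<union> set zs = V - {?M}" using d split by auto
    consider "ys = []" | "zs = []" | "ys \<noteq> []" "zs \<noteq> []" by blast
    then show "xs \<in> (#) ?M ` ?W \<union> (\<lambda>ys. ys @ [?M]) ` ?W"
    proof cases
      case 1
      then have "zs \<in> ?W" using d split sets list_peaks_Cons_greatest[of zs ?M] lt
        by (auto simp: peak_words_def)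
      then show ?thesis using 1 split by simp
    next
      case 2
      then have "ys \<in> ?W" using d split sets list_peaks_snoc_greatest[of ys ?M] lt
        by (auto simp: peak_words_def)
      then show ?thesis using 2 split by simp
    next
      case 3
      then have "last ys < ?M" "hd zs < ?M" using sets lt by (metis Un_iff last_in_set, metis Un_iff hd_in_set)
      then have "Suc (length ys) \<in> list_peaks xs"
        using 3 by (auto simp: list_peaks_def split nth_append last_conv_nth hd_conv_nth)
      then show ?thesis using d by simp
    qed
  next
    fix xs assume "xs \<in> (#) ?M ` ?W \<union> (\<lambda>ys. ys @ [?M]) ` ?W"
    then show "xs \<in> peak_words V {}"
    proof
      assume "xs \<in> (#) ?M ` ?W"
      then obtain ys where "xs = ?M # ys" "ys \<in> ?W" by blast
      then show ?thesis using M lt list_peaks_Cons_greatest[of ys ?M] by (auto simp: peak_words_def)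
    next
      assume "xs \<in> (\<lambda>ys. ys @ [?M]) ` ?W"
      then obtain ys where "xs = ys @ [?M]" "ys \<in> ?W" by blast
      then show ?thesis using M lt list_peaks_snoc_greatest[of ys ?M] by (auto simp: peak_words_def)
    qed
  qed
  moreover have "(#) ?M ` ?W \<inter> (\<lambda>ys. ys @ [?M]) ` ?W = {}"
  proof -
    \<comment> \<open>Equality would put \<open>?M\<close> among the letters of \<open>zs\<close>,
      unless \<open>zs\<close> is empty, which \<open>cV\<close> excludes.\<close>
    have False if "ys \<in> ?W" "zs \<in> ?W" "?M # ys = zs @ [?M]" for ys zs
    proof (cases zs)
      case Nil
      then show False using length_peak_words[OF that(2)] cV by simp
    next
      case (Cons a as)
      then show False using that by (auto simp: peak_words_def)
    qed
    then show ?thesis by blast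
  qed
  ultimately show ?case
    using Suc.prems(1) by (simp add: card_Un_disjoint card_image inj_on_def W)
qed

lemma card_no_peak_perms: "0 < n \<Longrightarrow> card (peak_perms {} n) = 2 ^ (n - 1)"
  using card_no_peak_words[of "{1..n}" "n - 1"] card_peak_words[of "{1..n}" "{}"] by simp

section \<open>Reversal\<close>

lemma list_peaks_rev: "list_peaks (rev xs) = (\<lambda>x. length xs + 1 - x) ` list_peaks xs"
proof -
  let ?n = "length xs"
  \<comment> \<open>Reversal swaps the two neighbours of a position, and the peak condition is
    symmetric in them.\<close>
  have iff: "i \<in> list_peaks (rev xs) \<longleftrightarrow> ?n + 1 - i \<in> list_peaks xs" if "1 < i" "i < ?n" for i
  proof -
    have "?n + 1 - i - 2 = ?n - Suc i" "?n + 1 - i - 1 = ?n - Suc (i - 1)"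
      "?n + 1 - i = ?n - Suc (i - 2)" using that by auto
    then show ?thesis using that by (auto simp: list_peaks_def rev_nth)
  qed
  have rng: "1 < i \<and> i < ?n" if "i \<in> list_peaks xs \<or> i \<in> list_peaks (rev xs)" for i
    using that by (auto simp: list_peaks_def)
  show ?thesis
  proof (intro equalityI subsetI)
    fix i assume i: "i \<in> list_peaks (rev xs)"
    then have "?n + 1 - i \<in> list_peaks xs" "i = ?n + 1 - (?n + 1 - i)"
      using iff[of i] rng[of i] by auto
    then show "i \<in> (\<lambda>x. ?n + 1 - x) ` list_peaks xs" by blast
  next
    fix i assume "i \<in> (\<lambda>x. ?n + 1 - x) ` list_peaks xs"
    then obtain x where x: "x \<in> list_peaks xs" "i = ?n + 1 - x" by blast
    then have "1 < i" "i < ?n" "?n + 1 - i = x" using rng[of x] by auto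
    then show "i \<in> list_peaks (rev xs)" using iff[of i] x by simp
  qed
qed

text \<open>Reversing words is an involution. On \<open>{..n}\<close> the map
  \<open>n + 1 - x\<close> is not truncated, so it undoes itself on \<open>S\<close>.\<close>

lemma card_peak_perms_reverse:
  assumes "S \<subseteq> {..n}"
  shows "card (peak_perms ((\<lambda>x. n + 1 - x) ` S) n) = card (peak_perms S n)"
proof -
  let ?r = "\<lambda>x. n + 1 - x"
  have rr: "?r ` ?r ` S = S" using assms by (force simp: image_image)
  have rev: "rev xs \<in> peak_words {1..n} (?r ` T)" if "xs \<in> peak_words {1..n} T" for xs T
    using that length_peak_words[OF that] by (auto simp: peak_words_def list_peaks_rev)
  have "bij_betw rev (peak_words {1..n} S) (peak_words {1..n} (?r ` S))"
    by (rule bij_betwI[where g = rev]) (use rev[of _ S] rev[of _ "?r ` S"] rr in auto)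
  from bij_betw_same_card[OF this] show ?thesis by (simp add: card_peak_words)
qed

lemma peak_perms_nonempty_imp:
  assumes "card (peak_perms S n) \<noteq> 0" "x \<in> S"
  shows "1 < x" "x < n" "Suc x \<notin> S"
proof -
  obtain \<pi> where "peak_set n \<pi> = S"
    using assms(1) by (metis (mono_tags, lifting) card.empty ex_in_conv mem_Collect_eq peak_perms_def)
  then show "1 < x" "x < n" "Suc x \<notin> S" using assms(2) by (auto simp: peak_set_def)
qed

section \<open>Binomial coefficients as polynomials\<close>

text \<open>As a product of linear factors, so that degree and nonvanishing can be read off. Its
  values are generalized binomial coefficients, hence integers at integers.\<close>

definition binomial_poly :: "nat \<Rightarrow> rat poly" where
  "binomial_poly k = smult (1 / fact k) (\<Prod>i<k. [:- of_nat i, 1:])"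

lemma poly_binomial_poly: "poly (binomial_poly k) x = x gchoose k"
  by (simp add: binomial_poly_def poly_prod gbinomial_prod_rev atLeast0LessThan)

lemma binomial_poly_nonzero: "binomial_poly k \<noteq> 0"
  by (simp add: binomial_poly_def)

lemma degree_binomial_poly: "degree (binomial_poly k) = k"
  by (simp add: binomial_poly_def degree_prod_sum_eq)

section \<open>Induction on the left block\<close>

text \<open>
  The right block contributes the positions \<open>n - j\<close>, \<open>j \<in> J\<close>, and enters the induction only through
  its own polynomial \<open>q\<close>. The assumption \<open>j + 2 \<le> b\<close> keeps these subtractions from being truncated.
\<close>

lemma peak_polynomial_prepend:
  fixes q :: "rat poly"
  assumes "finite J" "\<forall>j\<in>J. j + 2 \<le> b" "1 \<le> b"
    and "\<forall>k :: int. poly q (of_int k) \<in> \<int>"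
    and "\<forall>n\<ge>b. of_nat (card (peak_perms ((\<lambda>j. n - j) ` J) n)) = poly q (of_nat n) * 2 ^ (n - card J - 1)"
    and "\<forall>i\<in>I. i \<le> M"
  shows "\<exists>p :: rat poly. (\<forall>k :: int. poly p (of_int k) \<in> \<int>) \<and> degree p \<le> (M - 1) + degree q \<and>
    (\<forall>n\<ge>b + M. of_nat (card (peak_perms (I \<union> (\<lambda>j. n - j) ` J) n)) =
        poly p (of_nat n) * 2 ^ (n - card I - card J - 1)) \<and>
    (\<forall>n\<ge>b + M. card (peak_perms (I \<union> (\<lambda>j. n - j) ` J) n) \<noteq> 0 \<longrightarrow>
        (\<exists>n'\<ge>b. card (peak_perms ((\<lambda>j. n' - j) ` J) n') \<noteq> 0) \<and>
        (M \<in> I \<or> M = 0 \<longrightarrow> degree p = (M - 1) + degree q))"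
  using assms
\<comment> \<open>The right block is generalized too, since the step also uses the case of an empty
  one.\<close>
proof (induction M arbitrary: I J b q rule: less_induct)
  case (less M I J b q)
  note J = less.prems(1,2) and b = less.prems(3) and q_int = less.prems(4)
    and q_val = less.prems(5) and I = less.prems(6)
  define R where "R n = (\<lambda>j. n - j) ` J" for n
  define N where "N S n = card (peak_perms S n)" for S n
  have finI: "finite I" using I by (intro finite_subset[of I "{..M}"]) auto
  have cardJ: "card J + 1 \<le> b"
  proof -
    have "J \<subseteq> {..<b - 1}" using J by force
    from card_mono[OF _ this] b show ?thesis by simp
  qed
  \<comment> \<open>If all counts vanish the zero polynomial serves: the exact degree is claimed
    only where some count is nonzero.\<close>
  have zero: ?case if z: "\<And>n. n \<ge> b + M \<Longrightarrow> N (I \<union> R n) n = 0"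
    using z by (intro exI[of _ 0]) (auto simp: N_def R_def)
  show ?case
  proof (cases "M \<in> I")
    case False
    show ?thesis
    proof (cases M)
      case 0
      then have "I = {}" using I False by auto
      with 0 q_int q_val show ?thesis by (intro exI[of _ q]) auto
    next
      case (Suc m)
      \<comment> \<open>\<open>M\<close> is only an upper bound for \<open>I\<close> and can be
        lowered; the exact degree is not claimed here.\<close>
      have "\<forall>i\<in>I. i \<le> m" using I False Suc by (metis le_SucE)
      from less.IH[OF _ J b q_int q_val this] Suc obtain p :: "rat poly" where
        "\<forall>k :: int. poly p (of_int k) \<in> \<int>" "degree p \<le> (m - 1) + degree q"
        "\<forall>n\<ge>b + m. of_nat (card (peak_perms (I \<union> (\<lambda>j. n - j) ` J) n)) =
          poly p (of_nat n) * 2 ^ (n - card I - card J - 1)"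
        "\<forall>n\<ge>b + m. card (peak_perms (I \<union> (\<lambda>j. n - j) ` J) n) \<noteq> 0 \<longrightarrow>
          (\<exists>n'\<ge>b. card (peak_perms ((\<lambda>j. n' - j) ` J) n') \<noteq> 0)"
        by blast
      note p = this
      have le: "b + m \<le> n" if "b + M \<le> n" for n using that Suc by simp
      have "degree p \<le> (M - 1) + degree q" using p(2) Suc by simp
      then show ?thesis
        using p(1) p(3)[rule_format, OF le] p(4)[rule_format, OF le] False Suc
        by (intro exI[of _ p]) blast
    qed
  next
    case MI: True
    show ?thesis
    proof (cases "(\<exists>i\<in>I. i < 2) \<or> M - 1 \<in> I")
      case True
      \<comment> \<open>Such a peak set is impossible: peaks lie at 2 or later and are never
        adjacent.\<close>
      have "N (I \<union> R n) n = 0" for n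
      proof (rule ccontr)
        assume nz: "N (I \<union> R n) n \<noteq> 0"
        have gt: "1 < i" "Suc i \<notin> I" if "i \<in> I" for i
          using peak_perms_nonempty_imp[OF nz[unfolded N_def], of i] that by auto
        then have "M - 1 \<in> I" using True by fastforce
        moreover have "Suc (M - 1) = M" using gt[OF MI] by simp
        ultimately show False using gt(2) MI by metis
      qed
      then show ?thesis by (rule zero)
    next
      case False
      define m where "m = M - 1"
      define A where "A = I - {M}"
      have M2: "2 \<le> M" using MI False by force
      have M: "M = Suc m" and m: "1 \<le> m" using M2 by (auto simp: m_def)
      have A: "i < m \<and> 2 \<le> i" if "i \<in> A" for i
      proof -
        have "i \<le> M" "i \<noteq> M" "i \<noteq> m" "2 \<le> i" using that I False by (auto simp: A_def m_def not_less)
        then show ?thesis by (simp add: M)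
      qed
      have mA: "m \<notin> A" using A by blast
      have IA: "I = insert M A" using MI by (auto simp: A_def)
      have finA: "finite A" using finI by (simp add: A_def)
      have cardI: "card I = Suc (card A)" using card.remove[OF finI MI] by (simp add: A_def)
      have cardA: "card A + 1 \<le> m"
      proof -
        have "A \<subseteq> {1..<m}" using A by force
        from card_mono[OF _ this] m show ?thesis by simp
      qed
      have "\<forall>i\<in>A. i \<le> m" using A by (simp add: less_imp_le)
      from less.IH[OF _ J b q_int q_val this] M obtain p1 :: "rat poly" where
        p1: "\<forall>k :: int. poly p1 (of_int k) \<in> \<int>" "degree p1 \<le> (m - 1) + degree q"
        "\<forall>n\<ge>b + m. of_nat (N (A \<union> R n) n) = poly p1 (of_nat n) * 2 ^ (n - card A - card J - 1)"
        unfolding N_def R_def by blast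
      have "\<forall>i\<in>insert m A. i \<le> m" using A by (simp add: less_imp_le)
      from less.IH[OF _ J b q_int q_val this] M obtain p2 :: "rat poly" where
        p2: "\<forall>k :: int. poly p2 (of_int k) \<in> \<int>" "degree p2 \<le> (m - 1) + degree q"
        "\<forall>n\<ge>b + m. of_nat (N (insert m A \<union> R n) n) =
          poly p2 (of_nat n) * 2 ^ (n - card (insert m A) - card J - 1)"
        unfolding N_def R_def by blast
      \<comment> \<open>The left part alone: empty right block, \<open>b = 1\<close>,
        \<open>q = 1\<close>. The bound is \<open>m - 1\<close> rather than \<open>m\<close> so that
        the resulting formula already holds at \<open>n = m\<close>.\<close>
      have "m - 1 < M" "\<forall>i\<in>A. i \<le> m - 1" using A M by fastforce+
      from less.IH[of "m - 1" "{}" 1 1, OF this(1) _ _ _ _ _ this(2)] obtain p3 :: "rat poly" where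
        p3: "\<forall>k :: int. poly p3 (of_int k) \<in> \<int>"
        "\<forall>n\<ge>1 + (m - 1). of_nat (N A n) = poly p3 (of_nat n) * 2 ^ (n - card A - 1)"
        unfolding N_def by (auto simp: card_no_peak_perms)
      define c where "c = poly p3 (of_nat m)"
      have c_int: "c \<in> \<int>" using p3(1)[rule_format, of "int m"] by (simp add: c_def)
      have NA: "of_nat (N A m) = c * 2 ^ (m - card A - 1)" using p3(2) m by (simp add: c_def)
      \<comment> \<open>\<open>T\<close> takes the value \<open>(n choose m) * q(n - m)\<close> at
        \<open>n\<close>: choice of the first \<open>m\<close> values times the polynomial factor of
        the right part.\<close>
      define T where "T = binomial_poly m * pcompose q [:- of_nat m, 1:]"
      \<comment> \<open>The recurrence solved for \<open>I \<union> R n\<close>. \<open>A\<close>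
        has one peak fewer than \<open>I\<close>, so its power of 2 is twice as large, whence the
        factor 2; \<open>insert m A\<close> has as many as \<open>I\<close>.\<close>
      define p where "p = smult c T - smult 2 p1 - p2"
      have rec: "(n choose m) * N A m * N (R (n - m)) (n - m) =
          N (A \<union> R n) n + N (insert m A \<union> R n) n + N (I \<union> R n) n" if n: "n \<ge> b + M" for n
      proof -
        have R2: "R (n - m) \<subseteq> {2..}" using J n M by (force simp: R_def)
        have Rn: "(+) m ` R (n - m) = R n"
          unfolding R_def image_image by (rule image_cong) (use J n M in force)+
        have "A \<subseteq> {..<m}" "m \<le> n" using A n M by auto
        from peak_perms_recurrence[OF this(1) R2 this(2)] show ?thesis
          by (simp add: N_def Rn IA M)
      qed
      have T_int: "poly T (of_int k) \<in> \<int>" for k :: int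
      proof -
        have "poly (pcompose q [:- of_nat m, 1:]) (of_int k) = poly q (of_int (k - int m))"
          by (simp add: poly_pcompose)
        moreover have "poly (binomial_poly m) (of_int k) \<in> \<int>"
          unfolding poly_binomial_poly of_int_gbinomial[symmetric] by (rule Ints_of_int)
        ultimately show ?thesis using q_int by (simp only: T_def poly_mult Ints_mult)
      qed
      have p_int: "poly p (of_int k) \<in> \<int>" for k :: int
        using T_int[of k] p1(1) p2(1) c_int by (simp add: p_def)
      have degT_le: "degree T \<le> m + degree q"
        using degree_mult_le[of "binomial_poly m" "pcompose q [:- of_nat m, 1:]"]
        by (simp add: T_def degree_binomial_poly degree_pcompose)
      \<comment> \<open>Strict because \<open>m \<ge> 1\<close>; hence these terms cannot cancel the
        leading term of \<open>smult c T\<close>.\<close>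
      have deg_rest: "degree (- smult 2 p1 - p2) < m + degree q"
      proof -
        have "degree (- smult 2 p1 - p2) \<le> (m - 1) + degree q"
          using p1(2) p2(2) by (intro degree_diff_le) simp_all
        also have "\<dots> < m + degree q" using m by simp
        finally show ?thesis .
      qed
      have p_alt: "p = smult c T + (- smult 2 p1 - p2)" by (simp add: p_def)
      have p_deg: "degree p \<le> (M - 1) + degree q"
        unfolding p_alt using degT_le deg_rest degree_smult_le[of c T]
        by (intro degree_add_le) (auto simp: M)
      have p_val: "of_nat (N (I \<union> R n) n) = poly p (of_nat n) * 2 ^ (n - card I - card J - 1)"
        if n: "n \<ge> b + M" for n
      proof -
        \<comment> \<open>The two parts each contribute a \<open>- 1\<close> to the exponent. One of
          them accounts for the peak \<open>M\<close>, which neither part shows.\<close>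
        define e where "e = n - card I - card J - 1"
        have e1: "n - card A - card J - 1 = Suc e" and e2: "n - card (insert m A) - card J - 1 = e"
          and e3: "(m - card A - 1) + (n - m - card J - 1) = e"
          using n M cardJ cardA cardI finA mA by (auto simp: e_def)
        have NR: "of_nat (N (R (n - m)) (n - m)) = poly q (of_nat (n - m)) * 2 ^ (n - m - card J - 1)"
          unfolding N_def R_def by (rule q_val[rule_format]) (use n M in simp)
        have T_val: "of_nat (n choose m) * poly q (of_nat (n - m)) = poly T (of_nat n)"
          using n M by (simp add: T_def poly_pcompose poly_binomial_poly binomial_gbinomial of_nat_diff)
        have "of_nat ((n choose m) * N A m * N (R (n - m)) (n - m)) =
            c * (of_nat (n choose m) * poly q (of_nat (n - m))) *
            (2 ^ (m - card A - 1) * 2 ^ (n - m - card J - 1))"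
          by (simp only: of_nat_mult NA NR mult_ac)
        also have "\<dots> = c * poly T (of_nat n) * 2 ^ e"
          by (simp only: T_val e3 flip: power_add)
        finally have "c * poly T (of_nat n) * 2 ^ e =
            2 * poly p1 (of_nat n) * 2 ^ e + poly p2 (of_nat n) * 2 ^ e + of_nat (N (I \<union> R n) n)"
          using rec[OF n] p1(3)[rule_format, of n] p2(3)[rule_format, of n] n M
          by (simp add: e1[simplified] e2[simplified])
        then show ?thesis unfolding e_def[symmetric] by (simp add: p_def algebra_simps)
      qed
      \<comment> \<open>A nonzero count makes the left side of \<open>rec\<close> nonzero, so
        \<open>c\<close> and \<open>q\<close> are nonzero and \<open>T\<close> has full degree. The
        witness for the right block is \<open>n - m\<close>.\<close>
      have nz: "(\<exists>n'\<ge>b. N (R n') n' \<noteq> 0) \<and> degree p = (M - 1) + degree q"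
        if n: "n \<ge> b + M" and nz: "N (I \<union> R n) n \<noteq> 0" for n
      proof -
        have "(n choose m) * N A m * N (R (n - m)) (n - m) \<noteq> 0" using rec[OF n] nz by simp
        then have "N A m \<noteq> 0" and RN: "N (R (n - m)) (n - m) \<noteq> 0" by auto
        have "c \<noteq> 0" using NA \<open>N A m \<noteq> 0\<close> by auto
        have "n - m \<ge> b" using n M by simp
        have "q \<noteq> 0" using q_val[rule_format, OF \<open>n - m \<ge> b\<close>] RN by (auto simp: N_def R_def)
        then have "degree (smult c T) = m + degree q"
          using \<open>c \<noteq> 0\<close> binomial_poly_nonzero
          by (simp add: T_def degree_mult_eq degree_binomial_poly degree_pcompose pcompose_eq_0_iff)
        then have "degree p = m + degree q"
          unfolding p_alt using deg_rest by (simp add: degree_add_eq_left)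
        then show ?thesis using RN \<open>n - m \<ge> b\<close> M by auto
      qed
      show ?thesis
        using p_int p_deg p_val nz unfolding N_def R_def by (intro exI[of _ p]) blast
    qed
  qed
qed

section \<open>Combining the two blocks\<close>

theorem theorem4p1:
  fixes s t :: nat and i j :: "nat \<Rightarrow> nat"
  assumes "strict_mono_on {1..s} i" and "strict_mono_on {1..t} j"
    and "\<exists>n. two_sided_ok s t i j n \<and> card (peak_perms (two_sided_set s t i j n) n) \<noteq> 0"
  shows "\<exists>p :: rat poly.
      (\<forall>k :: int. poly p (of_int k) \<in> \<int>) \<and>
      (\<forall>n. two_sided_ok s t i j n \<and> card (peak_perms (two_sided_set s t i j n) n) \<noteq> 0 \<longrightarrow>
         of_nat (card (peak_perms (two_sided_set s t i j n) n)) =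
           poly p (of_nat n) * 2 ^ (n - card (two_sided_set s t i j n) - 1)) \<and>
      degree p =
        (if s = 0 \<and> t = 0 then 0
         else if s > 0 \<and> t = 0 then i s - 1
         else if s = 0 \<and> t > 0 then j t
         else i s + j t - 1)"
proof -
  define I where "I = i ` {1..s}"
  define J where "J = j ` {1..t}"
  define M where "M = (if s = 0 then 0 else i s)"
  define b where "b = (if t = 0 then 1 else j t + 2)"
  define P where "P n \<longleftrightarrow> two_sided_ok s t i j n \<and> card (peak_perms (two_sided_set s t i j n) n) \<noteq> 0" for n
  have set_eq: "two_sided_set s t i j n = I \<union> (\<lambda>j. n - j) ` J" for n
    by (simp add: two_sided_set_def I_def J_def image_image)
  have I_le: "\<forall>x\<in>I. x \<le> M"
    using strict_mono_on_leD[OF assms(1)] by (auto simp: I_def M_def)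
  have MI: "M \<in> I \<or> M = 0" by (auto simp: I_def M_def)
  have J_le: "x \<le> j t" if "x \<in> J" for x
    using strict_mono_on_leD[OF assms(2)] that by (auto simp: J_def)
  have J_b: "\<forall>x\<in>J. x + 2 \<le> b" using J_le by (auto simp: b_def J_def)
  have finJ: "finite J" and finI: "finite I" by (simp_all add: J_def I_def)
  have cardJ: "card J = t" and cardI: "card I = s"
    using assms(1,2) by (simp_all add: J_def I_def card_image strict_mono_on_imp_inj_on)
  have b1: "1 \<le> b" by (simp add: b_def)
  \<comment> \<open>Peaks are not adjacent, so the blocks leave a gap:
    \<open>n - j t \<ge> i s + 2\<close> if both are nonempty. This is exactly the range of the
    induction lemma.\<close>
  have large: "n \<ge> b + M" and M_pos: "s > 0 \<Longrightarrow> 1 < M" if "P n" for n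
  proof -
    have ok: "two_sided_ok s t i j n" and nz: "card (peak_perms (I \<union> (\<lambda>j. n - j) ` J) n) \<noteq> 0"
      using that by (auto simp: P_def set_eq)
    have i: "1 < i s \<and> i s < n \<and> Suc (i s) \<notin> I \<union> (\<lambda>j. n - j) ` J" if "s > 0"
      using peak_perms_nonempty_imp[OF nz, of "i s"] that by (auto simp: I_def)
    have jin: "n - j t \<in> I \<union> (\<lambda>j. n - j) ` J" if "t > 0" using that by (auto simp: J_def)
    have jj: "1 < n - j t" if "t > 0"
      using peak_perms_nonempty_imp[OF nz jin[OF that]] by simp
    show "s > 0 \<Longrightarrow> 1 < M" using i by (simp add: M_def)
    have "Suc (i s) \<noteq> n - j t" if "s > 0" "t > 0" using i jin that by metis
    then show "n \<ge> b + M"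
      using ok i jj by (cases "s = 0"; cases "t = 0") (auto simp: b_def M_def two_sided_ok_def)
  qed
  have cardS: "card (two_sided_set s t i j n) = s + t" if "P n" for n
  proof -
    have bn: "b + M \<le> n" using large[OF that] .
    have inj: "inj_on (\<lambda>j. n - j) J" using J_b bn by (intro inj_onI) force
    have "I \<inter> (\<lambda>j. n - j) ` J = {}" using I_le J_b bn by force
    then show ?thesis
      using finI finJ by (simp add: set_eq card_Un_disjoint card_image[OF inj] cardI cardJ)
  qed
  have "\<exists>q :: rat poly. (\<forall>k :: int. poly q (of_int k) \<in> \<int>) \<and>
      (\<forall>n\<ge>b. of_nat (card (peak_perms ((\<lambda>j. n - j) ` J) n)) = poly q (of_nat n) * 2 ^ (n - card J - 1)) \<and>
      ((\<exists>n\<ge>b. card (peak_perms ((\<lambda>j. n - j) ` J) n) \<noteq> 0) \<longrightarrow> degree q = (if t = 0 then 0 else j t))"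
  proof (cases "t = 0")
    case True
    then show ?thesis by (intro exI[of _ 1]) (auto simp: J_def b_def card_no_peak_perms)
  next
    case False
    have rev: "card (peak_perms (Suc ` J) n) = card (peak_perms ((\<lambda>j. n - j) ` J) n)" if "n \<ge> b" for n
    proof -
      have "Suc ` J \<subseteq> {..n}" using J_b that by force
      from card_peak_perms_reverse[OF this] show ?thesis by (simp add: image_image)
    qed
    have le: "\<forall>x\<in>Suc ` J. x \<le> Suc (j t)" using J_le by simp
    have "Suc (j t) \<in> Suc ` J" using False by (auto simp: J_def)
    moreover have "card (Suc ` J) = card J" by (simp add: card_image)
    moreover have "b = 1 + Suc (j t)" using False by (simp add: b_def)
    ultimately show ?thesis
      \<comment> \<open>The reversed set is a left block with maximum \<open>Suc (j t)\<close>,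
        which gives degree \<open>Suc (j t) - 1 = j t\<close>.\<close>
      using peak_polynomial_prepend[of "{}" 1 1, OF _ _ _ _ _ le] False
      by (auto simp: card_no_peak_perms rev)
  qed
  then obtain q :: "rat poly" where q: "\<forall>k :: int. poly q (of_int k) \<in> \<int>"
      "\<forall>n\<ge>b. of_nat (card (peak_perms ((\<lambda>j. n - j) ` J) n)) = poly q (of_nat n) * 2 ^ (n - card J - 1)"
      "(\<exists>n\<ge>b. card (peak_perms ((\<lambda>j. n - j) ` J) n) \<noteq> 0) \<Longrightarrow> degree q = (if t = 0 then 0 else j t)"
    by blast
  obtain p :: "rat poly" where p: "\<forall>k :: int. poly p (of_int k) \<in> \<int>"
      "\<forall>n\<ge>b + M. of_nat (card (peak_perms (I \<union> (\<lambda>j. n - j) ` J) n)) =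
        poly p (of_nat n) * 2 ^ (n - card I - card J - 1)"
      "\<forall>n\<ge>b + M. card (peak_perms (I \<union> (\<lambda>j. n - j) ` J) n) \<noteq> 0 \<longrightarrow>
        (\<exists>n'\<ge>b. card (peak_perms ((\<lambda>j. n' - j) ` J) n') \<noteq> 0) \<and>
        (M \<in> I \<or> M = 0 \<longrightarrow> degree p = (M - 1) + degree q)"
    using peak_polynomial_prepend[OF finJ J_b b1 q(1,2) I_le] by blast
  \<comment> \<open>One nonzero count fixes the degree of \<open>p\<close> relative to
    \<open>q\<close>, and also yields a nonzero count for the right block alone, which fixes the
    degree of \<open>q\<close>.\<close>
  obtain n0 where n0: "P n0" using assms(3) by (auto simp: P_def)
  then have "(\<exists>n'\<ge>b. card (peak_perms ((\<lambda>j. n' - j) ` J) n') \<noteq> 0) \<and> degree p = (M - 1) + degree q"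
    using p(3) large[OF n0] MI by (auto simp: P_def set_eq)
  then have "degree p = (M - 1) + (if t = 0 then 0 else j t)" using q(3) by auto
  then have "degree p =
      (if s = 0 \<and> t = 0 then 0 else if s > 0 \<and> t = 0 then i s - 1
       else if s = 0 \<and> t > 0 then j t else i s + j t - 1)"
    \<comment> \<open>With \<open>i s > 1\<close> the truncated \<open>(i s - 1) + j t\<close>
      equals \<open>i s + j t - 1\<close>.\<close>
    using M_pos[OF n0] by (auto simp: M_def)
  moreover have "of_nat (card (peak_perms (two_sided_set s t i j n) n)) =
      poly p (of_nat n) * 2 ^ (n - card (two_sided_set s t i j n) - 1)" if "P n" for n
    using p(2)[rule_format, OF large[OF that]] cardS[OF that] by (simp add: set_eq cardI cardJ)
  ultimately show ?thesis using p(1) unfolding P_def by blast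
qed

end
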